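(* Consider a finite POMDP with neural-softmax transition and observation models satisfying the over-parameterized neural-softmax assumption stated in the context. Let $W=(W_p,W_\Phi)\in\mathcal D$ be an estimated parameter and $W^\star=(W_p^\star,W_\Phi^\star)\in\mathcal D$ the true parameter generating the POMDP. Fix an action sequence $(a_0,\dots,a_{t-1})$ and let $(b_k^W)_{k=0}^t$, $(b_k^{W^\star})_{k=0}^t$ be the corresponding belief processes computed on the same observations and actions, with the same prior $b_0^W=b_0^{W^\star}=\nu_0\in\Delta_{\mathbb S}$. Assume $$\alpha_{\mathrm{NN}}:=(1-\kappa_P^{\mathrm{NN}})(4-3\kappa_\Phi^{\mathrm{NN}})<1.$$ Let $\delta_{\mathrm{NN}}\in(0,1)$. Then on the event $\mathcal E^{\mathrm{NN}}_{\mathrm{lin}}(\delta_{\mathrm{NN}})$, for every $t\ge1$, $$\mathbb E\Big[\|b_t^W-b_t^{W^\star}\|_{\mathrm{TV}}\Big]\le\frac{1-\alpha_{\mathrm{NN}}^t}{1-\alpha_{\mathrm{NN}}}\,c_b^{\mathrm{NN}}(W,W^\star;\delta_{\mathrm{NN}}),$$ where the expectation is with respect to $\hat s_{1:t}\sim P_{W^\star}(\cdot\mid a_{0:t-1})$ and $$c_b^{\mathrm{NN}}(W,W^\star;\delta_{\mathrm{NN}}):=B^{\mathrm{NN}}\|W_\Phi-W_\Phi^\star\|_F+2\varepsilon_\Phi^{\mathrm{NN}}(m,\delta_{\mathrm{NN}})+(3-2\kappa_\Phi^{\mathrm{NN}})\Big(\frac{B^{\mathrm{NN}}}{2}\|W_p-W_p^\star\|_F+\varepsilon_p^{\mathrm{NN}}(m,\delta_{\mathrm{NN}})\Big).$$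 In particular, when $\varepsilon_p^{\mathrm{NN}}(m,\delta_{\mathrm{NN}})\to0$ and $\varepsilon_\Phi^{\mathrm{NN}}(m,\delta_{\mathrm{NN}})\to0$ as $m\to\infty$, the additive terms of $c_b^{\mathrm{NN}}$ vanish, i.e. $c_b^{\mathrm{NN}}(W,W^\star;\delta_{\mathrm{NN}})-\big(B^{\mathrm{NN}}\|W_\Phi-W_\Phi^\star\|_F+(3-2\kappa_\Phi^{\mathrm{NN}})\frac{B^{\mathrm{NN}}}{2}\|W_p-W_p^\star\|_F\big)\to0$, giving a Lipschitz-type bound in the neural parameters.
   Context: $\mathbb S$ (latent states), $\hat{\mathbb S}$ (observations), $\mathbb A$ (actions) are finite nonempty sets; $\Delta_X$ is the set of probability vectors on $X$; $\|\mu-\nu\|_{\mathrm{TV}}=\frac12\|\mu-\nu\|_1$; $\|\cdot\|_F$, $\langle\cdot,\cdot\rangle_F$ are the Frobenius norm and inner product. Neural scores. Let $m$ be even (width), and let $x_p(s,a,s')\in\mathbb R^{d_{x,p}}$, $x_\Phi(s,\hat s)\in\mathbb R^{d_{x,\Phi}}$ be fixed input encodings. For $W_p=(\omega_{p,1},\dots,\omega_{p,m})\in\mathbb R^{m\times d_{x,p}}$ and $W_\Phi=(\omega_{\Phi,1},\dots,\omega_{\Phi,m})\in\mathbb R^{m\times d_{x,\Phi}}$ and fixed signs $c_{p,i},c_{\Phi,i}\in\{-1,1\}$, set $$F_p(s,a,s';W_p)=\frac1{\sqrt m}\sum_{i=1}^mc_{p,i}\,\mathrm{ReLU}(\omega_{p,i}^\top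 x_p(s,a,s')),\quad F_\Phi(s,\hat s;W_\Phi)=\frac1{\sqrt m}\sum_{i=1}^mc_{\Phi,i}\,\mathrm{ReLU}(\omega_{\Phi,i}^\top x_\Phi(s,\hat s)),$$ $$P_{W_p}(s'\mid s,a)=\frac{e^{F_p(s,a,s';W_p)}}{\sum_{\bar s\in\mathbb S}e^{F_p(s,a,\bar s;W_p)}},\qquad \Phi_{W_\Phi}(\hat s\mid s)=\frac{e^{F_\Phi(s,\hat s;W_\Phi)}}{\sum_{\bar s\in\hat{\mathbb S}}e^{F_\Phi(s,\bar s;W_\Phi)}}.$$ Symmetric random initialization $W_{p,0},W_{\Phi,0}$: for $g\in\{p,\Phi\}$ and $i\le m/2$, independently $c_{g,i}$ is Rademacher and $\omega_{g,i,0}\sim\mathcal N(0,I_{d_{x,g}})$; then $c_{g,i+m/2}=-c_{g,i}$, $\omega_{g,i+m/2,0}=\omega_{g,i,0}$, and $W_{g,0}=(\omega_{g,1,0},\dots,\omega_{g,m,0})$. Hence $F_p(\cdot;W_{p,0})=0$ and $F_\Phi(\cdot;W_{\Phi,0})=0$ identically. Tangent features: $\phi_p^{\mathrm{NN}}(s,a,s'):=\nabla_{W_p}F_p(s,a,s';W_{p,0})$, $\phi_\Phi^{\mathrm{NN}}(s,\hat s):=\nabla_{W_\Phi}F_\Phi(s,\hat s;W_{\Phi,0})$ (with a fixed convention for $\mathrm{ReLU}'(0)\in[0,1]$). Linearized scores: $F^{\mathrm{lin}}_{p,W_p}(s,a,s')=F_p(s,a,s';W_{p,0})+\langle\phi_p^{\mathrm{NN}}(s,a,s'),W_p-W_{p,0}\rangle_F$,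 $F^{\mathrm{lin}}_{\Phi,W_\Phi}(s,\hat s)=F_\Phi(s,\hat s;W_{\Phi,0})+\langle\phi_\Phi^{\mathrm{NN}}(s,\hat s),W_\Phi-W_{\Phi,0}\rangle_F$. Let $\mathcal D=\mathcal D_p\times\mathcal D_\Phi$ be a bounded convex neighborhood of the initialization. For $\delta_{\mathrm{NN}}\in(0,1)$, $\mathcal E^{\mathrm{NN}}_{\mathrm{lin}}(\delta_{\mathrm{NN}})$ is the event (over the random initialization) that $$\sup_{W_p\in\mathcal D_p}\sup_{s,a,s'}|F_p(s,a,s';W_p)-F^{\mathrm{lin}}_{p,W_p}(s,a,s')|\le\varepsilon_p^{\mathrm{NN}}(m,\delta_{\mathrm{NN}})\ \text{ and }\ \sup_{W_\Phi\in\mathcal D_\Phi}\sup_{s,\hat s}|F_\Phi(s,\hat s;W_\Phi)-F^{\mathrm{lin}}_{\Phi,W_\Phi}(s,\hat s)|\le\varepsilon_\Phi^{\mathrm{NN}}(m,\delta_{\mathrm{NN}}),$$ where $\mathcal D$ and the levels $\varepsilon_p^{\mathrm{NN}},\varepsilon_\Phi^{\mathrm{NN}}\ge0$ are such that this event has probability at least $1-\delta_{\mathrm{NN}}$. Over-parameterized neural-softmax assumption: (i) there is $W^\star=(W_p^\star,W_\Phi^\star)\in\mathcal D$ such that the true POMDP has kernels $P_{W_p^\star},\Phi_{W_\Phi^\star}$; (ii) the reference points $W_{p,0}$ and $W_{\Phi,0}$ are symmetric random initializations, i.e. for $g\in\{p,\Phi\}$ and $i\le m/2$, independently $c_{g,i}$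 is Rademacher and $\omega_{g,i,0}\sim\mathcal N(0,I_{d_{x,g}})$, with $c_{g,i+m/2}=-c_{g,i}$, $\omega_{g,i+m/2,0}=\omega_{g,i,0}$ and $W_{g,0}=(\omega_{g,1,0},\dots,\omega_{g,m,0})$; (iii) for some $B^{\mathrm{NN}}<\infty$, $\|\phi_p^{\mathrm{NN}}(s,a,s')\|_F\le B^{\mathrm{NN}}$ and $\|\phi_\Phi^{\mathrm{NN}}(s,\hat s)\|_F\le B^{\mathrm{NN}}$ for all arguments. Neural Dobrushin coefficients: $$\kappa_P^{\mathrm{NN}}:=\inf_{W_p\in\mathcal D_p}\inf_{a,s,s''}\sum_{x\in\mathbb S}\min\{P_{W_p}(x\mid s,a),P_{W_p}(x\mid s'',a)\},\quad \kappa_\Phi^{\mathrm{NN}}:=\inf_{W_\Phi\in\mathcal D_\Phi}\inf_{s,s''}\sum_{\hat s\in\hat{\mathbb S}}\min\{\Phi_{W_\Phi}(\hat s\mid s),\Phi_{W_\Phi}(\hat s\mid s'')\}.$$ Belief process: $b_0^W=\nu_0$ and $b_{k+1}^W(s')\propto\Phi_{W_\Phi}(\hat s_{k+1}\mid s')\sum_sP_{W_p}(s'\mid s,a_k)b_k^W(s)$, normalized over $s'\in\mathbb S$. $P_{W^\star}(\cdot\mid a_{0:t-1})$ is the law of the observations when $s_0\sim\nu_0$, $s_{k+1}\sim P_{W_p^\star}(\cdot\mid s_k,a_k)$, $\hat s_k\sim\Phi_{W_\Phi^\star}(\cdot\mid s_k)$ for $k\ge1$, with the given fixed actions. *)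

theory Defs
  imports "HOL-Probability.Probability"
begin

section \<open>Weight matrices of variable width\<close>

text \<open>
  A weight matrix with \<open>m\<close> rows in \<open>real^'d\<close> is a function from row indices to rows whose rows
  \<open>i \<ge> m\<close> are zero. The width is a natural number, not a type, because it tends to infinity.
\<close>

type_synonym 'd weights = "nat \<Rightarrow> real^'d"

definition weight_space :: "nat \<Rightarrow> ('d::finite) weights set" where
  "weight_space m = {W. \<forall>i\<ge>m. W i = 0}"

definition frob_inner :: "nat \<Rightarrow> ('d::finite) weights \<Rightarrow> 'd weights \<Rightarrow> real" where
  "frob_inner m V W = (\<Sum>i<m. V i \<bullet> W i)"

definition frob_norm :: "nat \<Rightarrow> ('d::finite) weights \<Rightarrow> real" where
  "frob_norm m W = sqrt (frob_inner m W W)"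

definition wdiff :: "('d::finite) weights \<Rightarrow> 'd weights \<Rightarrow> 'd weights" where
  "wdiff V W = (\<lambda>i. V i - W i)"

definition bounded_convex_nbhd :: "nat \<Rightarrow> ('d::finite) weights \<Rightarrow> 'd weights set \<Rightarrow> bool" where
  "bounded_convex_nbhd m W0 D \<longleftrightarrow>
     D \<subseteq> weight_space m \<and>
     (\<exists>R. \<forall>W\<in>D. frob_norm m W \<le> R) \<and>
     (\<forall>V\<in>D. \<forall>W\<in>D. \<forall>u\<in>{0..1}. (\<lambda>i. (1 - u) *\<^sub>R V i + u *\<^sub>R W i) \<in> D) \<and>
     (\<exists>r>0. \<forall>W\<in>weight_space m. frob_norm m (wdiff W W0) < r \<longrightarrow> W \<in> D)"


section \<open>Neural scores, softmax kernels and tangent features\<close>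

definition relu :: "real \<Rightarrow> real" where
  "relu z = max 0 z"

text \<open>\<open>\<rho>\<close> is the value chosen for the derivative of ReLU at \<open>0\<close>.\<close>

definition relu_deriv :: "real \<Rightarrow> real \<Rightarrow> real" where
  "relu_deriv \<rho> z = (if z > 0 then 1 else if z = 0 then \<rho> else 0)"

definition score :: "nat \<Rightarrow> (nat \<Rightarrow> real) \<Rightarrow> ('d::finite) weights \<Rightarrow> real^'d \<Rightarrow> real" where
  "score m c W x = 1 / sqrt (real m) * (\<Sum>i<m. c i * relu (W i \<bullet> x))"

definition softmax :: "('b::finite \<Rightarrow> real) \<Rightarrow> 'b \<Rightarrow> real" where
  "softmax f y = exp (f y) / (\<Sum>z\<in>UNIV. exp (f z))"

definition nn_trans :: "('s::finite \<Rightarrow> 'a \<Rightarrow> 's \<Rightarrow> real^'d::finite) \<Rightarrow> nat \<Rightarrow> (nat \<Rightarrow> real) \<Rightarrow>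
    'd weights \<Rightarrow> 's \<Rightarrow> 'a \<Rightarrow> 's \<Rightarrow> real" where
  "nn_trans x m c W s a s' = softmax (\<lambda>z. score m c W (x s a z)) s'"

definition nn_obs :: "('s \<Rightarrow> 'o::finite \<Rightarrow> real^'d::finite) \<Rightarrow> nat \<Rightarrow> (nat \<Rightarrow> real) \<Rightarrow>
    'd weights \<Rightarrow> 's \<Rightarrow> 'o \<Rightarrow> real" where
  "nn_obs x m c W s y = softmax (\<lambda>z. score m c W (x s z)) y"

text \<open>
  Gradient of \<^term>\<open>\<lambda>W. score m c W x\<close> at \<open>W0\<close>, with \<^term>\<open>relu_deriv \<rho>\<close> in place of the derivative
  of ReLU. Lemma \<open>tangent_is_gradient\<close> below compares its rows with the actual gradient.
\<close>

definition tangent :: "real \<Rightarrow> nat \<Rightarrow> (nat \<Rightarrow> real) \<Rightarrow> ('d::finite) weights \<Rightarrow> real^'d \<Rightarrow> 'd weights" where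
  "tangent \<rho> m c W0 x =
     (\<lambda>i. if i < m then (1 / sqrt (real m) * (c i * relu_deriv \<rho> (W0 i \<bullet> x))) *\<^sub>R x else 0)"

definition lin_score :: "real \<Rightarrow> nat \<Rightarrow> (nat \<Rightarrow> real) \<Rightarrow> ('d::finite) weights \<Rightarrow> 'd weights \<Rightarrow> real^'d \<Rightarrow> real" where
  "lin_score \<rho> m c W0 W x = score m c W0 x + frob_inner m (tangent \<rho> m c W0 x) (wdiff W W0)"

lemma relu_has_derivative:
  assumes "z \<noteq> 0"
  shows "DERIV relu z :> relu_deriv \<rho> z"
proof (cases "z > 0")
  case True
  have "(relu has_real_derivative 1) (at z)"
    by (rule has_field_derivative_transform_within_open[OF DERIV_ident, of "{0<..}"])
      (use True in \<open>auto simp: relu_def\<close>)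
  then show ?thesis
    using True by (simp add: relu_deriv_def)
next
  case False
  with assms have "z < 0" by simp
  have "(relu has_real_derivative 0) (at z)"
    by (rule has_field_derivative_transform_within_open[OF DERIV_const, of "{..<0}"])
      (use \<open>z < 0\<close> in \<open>auto simp: relu_def\<close>)
  then show ?thesis
    using \<open>z < 0\<close> by (simp add: relu_deriv_def)
qed

lemma tangent_is_gradient:
  assumes "i < m" and "W i \<bullet> x \<noteq> 0"
  shows "GDERIV (\<lambda>w. score m c (W(i := w)) x) (W i) :> tangent \<rho> m c W x i"
proof -
  define rest where "rest = 1 / sqrt (real m) * (\<Sum>j\<in>{..<m} - {i}. c j * relu (W j \<bullet> x))"
  define k where "k = 1 / sqrt (real m) * c i"
  have eq: "score m c (W(i := w)) x = k * relu (w \<bullet> x) + rest" for w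
  proof -
    have "(\<Sum>j\<in>{..<m} - {i}. c j * relu ((W(i := w)) j \<bullet> x)) =
          (\<Sum>j\<in>{..<m} - {i}. c j * relu (W j \<bullet> x))"
      by (rule sum.cong) auto
    then show ?thesis
      unfolding score_def k_def rest_def using assms(1)
      by (simp add: sum.remove[of "{..<m}" i] distrib_left mult.assoc)
  qed
  have "((\<lambda>w. w \<bullet> x) has_derivative (\<lambda>h. h \<bullet> x)) (at (W i))"
    by (auto intro!: derivative_eq_intros)
  moreover have "(relu has_derivative (*) (relu_deriv \<rho> (W i \<bullet> x))) (at (W i \<bullet> x))"
    using relu_has_derivative[OF assms(2)] by (simp add: has_field_derivative_def)
  ultimately have "((\<lambda>w. relu (w \<bullet> x)) has_derivative (\<lambda>h. relu_deriv \<rho> (W i \<bullet> x) * (h \<bullet> x))) (at (W i))"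
    using diff_chain_at[of "\<lambda>w. w \<bullet> x" "\<lambda>h. h \<bullet> x" "W i" relu] by (simp add: o_def)
  then have "((\<lambda>w. k * relu (w \<bullet> x) + rest) has_derivative
      (\<lambda>h. k * (relu_deriv \<rho> (W i \<bullet> x) * (h \<bullet> x)))) (at (W i))"
    by (auto intro!: derivative_eq_intros)
  then show ?thesis
    unfolding gderiv_def eq using assms(1) by (simp add: tangent_def k_def mult.assoc)
qed


section \<open>Symmetric random initialization\<close>

definition std_gaussian :: "(real^'d::finite) measure" where
  "std_gaussian = density lborel (\<lambda>w. ennreal (\<Prod>b\<in>Basis. std_normal_density (w \<bullet> b)))"

text \<open>
  Only the first \<open>m/2\<close> pairs (sign, row) are drawn; \<open>init_signs\<close> and \<open>init_weights\<close> build the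
  remaining half from them.
\<close>

type_synonym 'd draws = "nat \<Rightarrow> real \<times> (real^'d)"

definition draws_law :: "nat \<Rightarrow> ('d::finite) draws measure" where
  "draws_law m =
     PiM {..<m div 2} (\<lambda>_. uniform_count_measure {-1, 1} \<Otimes>\<^sub>M std_gaussian)"

definition init_law :: "nat \<Rightarrow> (('p::finite) draws \<times> ('q::finite) draws) measure" where
  "init_law m = draws_law m \<Otimes>\<^sub>M draws_law m"

definition init_signs :: "nat \<Rightarrow> ('d::finite) draws \<Rightarrow> nat \<Rightarrow> real" where
  "init_signs m z = (\<lambda>i. if i < m div 2 then fst (z i) else - fst (z (i - m div 2)))"

definition init_weights :: "nat \<Rightarrow> ('d::finite) draws \<Rightarrow> 'd weights" where
  "init_weights m z =
     (\<lambda>i. if i < m div 2 then snd (z i) else if i < m then snd (z (i - m div 2)) else 0)"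

lemma prob_space_std_gaussian: "prob_space (std_gaussian :: (real^'d::finite) measure)"
proof
  have one: "(\<integral>\<^sup>+x. ennreal (std_normal_density x) \<partial>lborel) = 1"
    using prob_space.emeasure_space_1[OF prob_space_normal_density[of 1 0]]
    by (simp add: emeasure_density)
  have "emeasure (std_gaussian :: (real^'d) measure) (space std_gaussian) =
      (\<integral>\<^sup>+w. (\<Prod>b\<in>Basis. ennreal (std_normal_density (w \<bullet> b))) \<partial>(lborel :: (real^'d) measure))"
    by (simp add: std_gaussian_def emeasure_density prod_ennreal)
  also have "\<dots> = (\<Prod>b\<in>(Basis :: (real^'d) set). \<integral>\<^sup>+x. ennreal (std_normal_density x) \<partial>lborel)"
    by (rule nn_integral_lborel_prod) auto
  also have "\<dots> = 1"
    by (simp add: one)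
  finally show "emeasure (std_gaussian :: (real^'d) measure) (space std_gaussian) = 1" .
qed

lemma prob_space_init_law:
  "prob_space (init_law m :: (('p::finite) draws \<times> ('q::finite) draws) measure)"
  unfolding init_law_def draws_law_def
  by (intro prob_space_pair prob_space_PiM prob_space_std_gaussian prob_space_uniform_count_measure) auto

lemma score_init:
  assumes "even m"
  shows "score m (init_signs m z) (init_weights m z) x = 0"
proof -
  define h where "h = m div 2"
  have m: "m = h + h" using assms by (auto simp: h_def)
  have split: "(\<Sum>i<h + h. f i) = (\<Sum>i<h. f i) + (\<Sum>i<h. f (h + i))" for f :: "nat \<Rightarrow> real"
    using sum.nat_group[of f h 2] sum.atLeastLessThan_concat[of 0 h "h + h" f]
      sum.shift_bounds_nat_ivl[of f 0 h h]
    by (simp add: lessThan_atLeast0 add.commute)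
  show ?thesis
    unfolding score_def init_signs_def init_weights_def
    by (simp add: m split sum_negf)
qed


section \<open>The linearization event\<close>

text \<open>
  The neighborhoods \<open>D_p\<close>, \<open>D_Phi\<close> are centred at the random initialization and hence may depend on
  the outcome. The suprema are taken in \<^typ>\<open>ereal\<close>.
\<close>

definition lin_event ::
  "('s::finite \<Rightarrow> 'a::finite \<Rightarrow> 's \<Rightarrow> real^'p::finite) \<Rightarrow> ('s \<Rightarrow> 'o::finite \<Rightarrow> real^'q::finite) \<Rightarrow>
   real \<Rightarrow> nat \<Rightarrow> ('p draws \<times> 'q draws \<Rightarrow> 'p weights set) \<Rightarrow> ('p draws \<times> 'q draws \<Rightarrow> 'q weights set) \<Rightarrow>
   real \<Rightarrow> real \<Rightarrow> ('p draws \<times> 'q draws) set" where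
  "lin_event x_p x_Phi \<rho> m D_p D_Phi e_p e_Phi =
     {\<xi> \<in> space (init_law m).
        (SUP W\<in>D_p \<xi>. SUP s. SUP a. SUP s'.
           ereal \<bar>score m (init_signs m (fst \<xi>)) W (x_p s a s')
                  - lin_score \<rho> m (init_signs m (fst \<xi>)) (init_weights m (fst \<xi>)) W (x_p s a s')\<bar>)
          \<le> ereal e_p \<and>
        (SUP W\<in>D_Phi \<xi>. SUP s. SUP y.
           ereal \<bar>score m (init_signs m (snd \<xi>)) W (x_Phi s y)
                  - lin_score \<rho> m (init_signs m (snd \<xi>)) (init_weights m (snd \<xi>)) W (x_Phi s y)\<bar>)
          \<le> ereal e_Phi}"

text \<open>
  For \<open>\<delta> < 1\<close> the probability bound also forces the event to be measurable, since \<^const>\<open>measure\<close>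
  is \<open>0\<close> on non-measurable sets.
\<close>

definition lin_regime ::
  "('s::finite \<Rightarrow> 'a::finite \<Rightarrow> 's \<Rightarrow> real^'p::finite) \<Rightarrow> ('s \<Rightarrow> 'o::finite \<Rightarrow> real^'q::finite) \<Rightarrow>
   real \<Rightarrow> nat \<Rightarrow> real \<Rightarrow> ('p draws \<times> 'q draws \<Rightarrow> 'p weights set) \<Rightarrow> ('p draws \<times> 'q draws \<Rightarrow> 'q weights set) \<Rightarrow>
   real \<Rightarrow> real \<Rightarrow> bool" where
  "lin_regime x_p x_Phi \<rho> m \<delta> D_p D_Phi e_p e_Phi \<longleftrightarrow>
     even m \<and> 0 < m \<and> 0 \<le> e_p \<and> 0 \<le> e_Phi \<and>
     (\<forall>\<xi>\<in>space (init_law m).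
        bounded_convex_nbhd m (init_weights m (fst \<xi>)) (D_p \<xi>) \<and>
        bounded_convex_nbhd m (init_weights m (snd \<xi>)) (D_Phi \<xi>)) \<and>
     measure (init_law m) (lin_event x_p x_Phi \<rho> m D_p D_Phi e_p e_Phi) \<ge> 1 - \<delta>"


section \<open>Dobrushin coefficients\<close>

definition kappa_P :: "('s::finite \<Rightarrow> 'a::finite \<Rightarrow> 's \<Rightarrow> real^'p::finite) \<Rightarrow> nat \<Rightarrow> (nat \<Rightarrow> real) \<Rightarrow>
    'p weights set \<Rightarrow> real" where
  "kappa_P x m c D =
     (INF W\<in>D. INF a. INF s. INF s''. \<Sum>z\<in>UNIV. min (nn_trans x m c W s a z) (nn_trans x m c W s'' a z))"

definition kappa_Phi :: "('s::finite \<Rightarrow> 'o::finite \<Rightarrow> real^'q::finite) \<Rightarrow> nat \<Rightarrow> (nat \<Rightarrow> real) \<Rightarrow>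
    'q weights set \<Rightarrow> real" where
  "kappa_Phi x m c D =
     (INF W\<in>D. INF s. INF s''. \<Sum>y\<in>UNIV. min (nn_obs x m c W s y) (nn_obs x m c W s'' y))"


section \<open>Beliefs and the law of the observations\<close>

definition tv :: "('b::finite \<Rightarrow> real) \<Rightarrow> ('b \<Rightarrow> real) \<Rightarrow> real" where
  "tv \<mu> \<nu> = (1 / 2) * (\<Sum>z\<in>UNIV. \<bar>\<mu> z - \<nu> z\<bar>)"

text \<open>\<open>a k\<close> is the action at time \<open>k \<ge> 0\<close> and \<open>y k\<close> the observation at time \<open>k \<ge> 1\<close>; \<open>y 0\<close> is never used.\<close>

fun belief :: "('s::finite \<Rightarrow> 'a \<Rightarrow> 's \<Rightarrow> real) \<Rightarrow> ('s \<Rightarrow> 'o \<Rightarrow> real) \<Rightarrow> 's pmf \<Rightarrow>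
    (nat \<Rightarrow> 'a) \<Rightarrow> (nat \<Rightarrow> 'o) \<Rightarrow> nat \<Rightarrow> 's \<Rightarrow> real" where
  "belief P \<Phi> \<nu>0 a y 0 = pmf \<nu>0"
| "belief P \<Phi> \<nu>0 a y (Suc k) =
     (\<lambda>s'. \<Phi> s' (y (Suc k)) * (\<Sum>s\<in>UNIV. P s (a k) s' * belief P \<Phi> \<nu>0 a y k s) /
           (\<Sum>z\<in>UNIV. \<Phi> z (y (Suc k)) * (\<Sum>s\<in>UNIV. P s (a k) z * belief P \<Phi> \<nu>0 a y k s)))"

text \<open>
  Joint law of the state at time \<open>k\<close> and the observations at times \<open>1, \<dots>, k\<close>; the observation
  function is \<open>undefined\<close> at all other times.
\<close>

fun joint_law :: "('s \<Rightarrow> 'a \<Rightarrow> 's pmf) \<Rightarrow> ('s \<Rightarrow> 'o pmf) \<Rightarrow> 's pmf \<Rightarrow> (nat \<Rightarrow> 'a) \<Rightarrow> nat \<Rightarrow>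
    ('s \<times> (nat \<Rightarrow> 'o)) pmf" where
  "joint_law P \<Phi> \<nu>0 a 0 = map_pmf (\<lambda>s. (s, \<lambda>_. undefined)) \<nu>0"
| "joint_law P \<Phi> \<nu>0 a (Suc k) =
     bind_pmf (joint_law P \<Phi> \<nu>0 a k) (\<lambda>(s, y).
       bind_pmf (P s (a k)) (\<lambda>s'.
         map_pmf (\<lambda>u. (s', y(Suc k := u))) (\<Phi> s')))"

definition obs_law :: "('s \<Rightarrow> 'a \<Rightarrow> 's pmf) \<Rightarrow> ('s \<Rightarrow> 'o pmf) \<Rightarrow> 's pmf \<Rightarrow> (nat \<Rightarrow> 'a) \<Rightarrow> nat \<Rightarrow>
    (nat \<Rightarrow> 'o) pmf" where
  "obs_law P \<Phi> \<nu>0 a t = map_pmf snd (joint_law P \<Phi> \<nu>0 a t)"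

definition c_b :: "nat \<Rightarrow> real \<Rightarrow> real \<Rightarrow> real \<Rightarrow> real \<Rightarrow> ('p::finite) weights \<Rightarrow> 'p weights \<Rightarrow>
    ('q::finite) weights \<Rightarrow> 'q weights \<Rightarrow> real" where
  "c_b m B \<kappa>\<Phi> e_p e_Phi W_p W_p' W_Phi W_Phi' =
     B * frob_norm m (wdiff W_Phi W_Phi') + 2 * e_Phi
     + (3 - 2 * \<kappa>\<Phi>) * (B / 2 * frob_norm m (wdiff W_p W_p') + e_p)"

end

theory Submission
  imports Defs
begin

text \<open>
  The belief update is a prediction by the transition kernel followed by Bayes' rule for the observation kernel.
  Each of these is stable in total variation, up to the distance of the estimated kernel from the true one.

  Prediction contracts by the factor \<open>1 - \<kappa>P\<close> (Dobrushin) and adds the error \<open>eP\<close> of the transition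
  kernel (\<open>tv_push_perturb_le\<close>). Bayes' rule is not Lipschitz with a useful constant for a single
  observation, because the normalization may be tiny, but it is after averaging over an observation drawn
  from the true predictive law, which weights each observation by the normalization of the true update. The averaged error is at most the
  distance of the joint laws of state and observation plus the distance of their observation
  marginals, together \<open>(2 - \<kappa>\<Phi>) * tv \<mu> \<nu> + 2 * e\<Phi>\<close> (\<open>bayes_stability\<close>). Since the true belief is the
  conditional law of the state given the past observations (\<open>filtering_property\<close>), the observation
  has exactly this predictive law, given the past. Hence the expected errors \<open>E k\<close> satisfy
  \<open>E (Suc k) \<le> (1 - \<kappa>P) * (2 - \<kappa>\<Phi>) * E k + 2 * e\<Phi> + (2 - \<kappa>\<Phi>) * eP\<close>, and the claimed constants follow from
  \<open>2 - \<kappa>\<Phi> \<le> 3 - 2 * \<kappa>\<Phi> \<le> 4 - 3 * \<kappa>\<Phi>\<close> and summation of a geometric series.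

  The kernel errors come from the scores. On the linearization event each score is within \<open>\<epsilon>\<close> of
  an affine function of the weights with gradient bounded by \<open>B\<close>, so two scores differ by at most
  \<open>B * norm (W - W') + 2 * \<epsilon>\<close>, and softmax turns a uniform bound \<open>e\<close> on the difference of scores
  into a total variation bound \<open>e / 2\<close> (\<open>tv_softmax_le\<close>).
\<close>


section \<open>Total variation distance and softmax\<close>

definition prob_vec :: "('b::finite \<Rightarrow> real) \<Rightarrow> bool" where
  "prob_vec \<mu> \<longleftrightarrow> (\<forall>z. 0 \<le> \<mu> z) \<and> (\<Sum>z\<in>UNIV. \<mu> z) = 1"

lemma prob_vec_pmf: "prob_vec (pmf (p :: ('b::finite) pmf))"
  by (simp add: prob_vec_def sum_pmf_eq_1)

lemma softmax_pos: "0 < softmax f y"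
  by (auto simp: softmax_def intro!: divide_pos_pos sum_pos)

lemma prob_vec_softmax: "prob_vec (softmax f)"
proof -
  have "(\<Sum>z\<in>UNIV. exp (f z)) > 0"
    by (intro sum_pos) auto
  then show ?thesis
    using softmax_pos[of f] less_imp_le
    by (auto simp: prob_vec_def softmax_def simp flip: sum_divide_distrib)
qed

lemma tv_nonneg: "0 \<le> tv \<mu> \<nu>"
  by (simp add: tv_def sum_nonneg)

lemma tv_triangle: "tv \<mu> \<nu> \<le> tv \<mu> \<xi> + tv \<xi> \<nu>"
proof -
  have "(\<Sum>z\<in>UNIV. \<bar>\<mu> z - \<nu> z\<bar>) \<le> (\<Sum>z\<in>UNIV. \<bar>\<mu> z - \<xi> z\<bar> + \<bar>\<xi> z - \<nu> z\<bar>)"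
    by (intro sum_mono) linarith
  then show ?thesis
    by (simp add: tv_def sum.distrib)
qed

lemma tv_eq_overlap:
  assumes "prob_vec \<mu>" "prob_vec \<nu>"
  shows "tv \<mu> \<nu> = 1 - (\<Sum>z\<in>UNIV. min (\<mu> z) (\<nu> z))"
proof -
  have "(\<Sum>z\<in>UNIV. \<bar>\<mu> z - \<nu> z\<bar>) = (\<Sum>z\<in>UNIV. \<mu> z + \<nu> z - 2 * min (\<mu> z) (\<nu> z))"
    by (intro sum.cong) auto
  then show ?thesis
    using assms by (simp add: tv_def prob_vec_def sum.distrib sum_subtractf flip: sum_distrib_left)
qed

text \<open>
  By the arithmetic-geometric mean inequality, \<open>2 e \<bar>k\<bar> \<le> k\<^sup>2 + e\<^sup>2\<close>, so a bound on the variance gives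
  one on the mean absolute deviation. The resulting constant is \<open>e\<close>, not the \<open>2 e\<close> of the triangle
  inequality.
\<close>

lemma mean_abs_deviation_le:
  assumes p: "prob_vec p" and h: "\<And>z. \<bar>h z\<bar> \<le> e"
  shows "(\<Sum>z\<in>UNIV. p z * \<bar>h z - (\<Sum>x\<in>UNIV. p x * h x)\<bar>) \<le> e"
proof -
  define c where "c = (\<Sum>x\<in>UNIV. p x * h x)"
  have p0: "0 \<le> p z" and p1: "(\<Sum>z\<in>UNIV. p z) = 1" for z
    using p by (auto simp: prob_vec_def)
  have e0: "0 \<le> e" using h[of undefined] by linarith
  have "2 * e * (\<Sum>z\<in>UNIV. p z * \<bar>h z - c\<bar>) \<le> (\<Sum>z\<in>UNIV. p z * ((h z - c)\<^sup>2 + e\<^sup>2))"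
  proof -
    have "2 * e * \<bar>h z - c\<bar> \<le> (h z - c)\<^sup>2 + e\<^sup>2" for z
      using sum_squares_bound[of e "\<bar>h z - c\<bar>"] by simp
    then have "p z * (2 * e * \<bar>h z - c\<bar>) \<le> p z * ((h z - c)\<^sup>2 + e\<^sup>2)" for z
      using p0 by (intro mult_left_mono) auto
    then show ?thesis
      unfolding sum_distrib_left by (intro sum_mono) (simp add: mult_ac)
  qed
  also have "\<dots> = (\<Sum>z\<in>UNIV. p z * (h z)\<^sup>2 - 2 * c * (p z * h z) + (c\<^sup>2 + e\<^sup>2) * p z)"
    by (intro sum.cong) (auto simp: power2_eq_square algebra_simps)
  also have "\<dots> = (\<Sum>z\<in>UNIV. p z * (h z)\<^sup>2) - c\<^sup>2 + e\<^sup>2"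
    by (simp add: sum.distrib sum_subtractf p1 power2_eq_square c_def flip: sum_distrib_left)
  also have "\<dots> \<le> 2 * e * e"
  proof -
    have "(\<Sum>z\<in>UNIV. p z * (h z)\<^sup>2) \<le> (\<Sum>z\<in>UNIV. p z * e\<^sup>2)"
      using h e0 p0 by (intro sum_mono mult_left_mono) (auto simp: abs_le_square_iff[symmetric])
    then have "(\<Sum>z\<in>UNIV. p z * (h z)\<^sup>2) \<le> e * e"
      by (simp add: p1 power2_eq_square flip: sum_distrib_right)
    then show ?thesis
      using zero_le_power2[of c] unfolding power2_eq_square[of e] by linarith
  qed
  finally have le: "2 * e * (\<Sum>z\<in>UNIV. p z * \<bar>h z - c\<bar>) \<le> 2 * e * e" .
  show ?thesis
  proof (cases "e = 0")
    case True
    then have "h z = 0" for z using h[of z] by simp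
    then show ?thesis using True by simp
  next
    case False
    then show ?thesis using le e0 by (simp add: c_def)
  qed
qed

text \<open>
  Along the segment \<open>g + u h\<close> with \<open>h = f - g\<close>, the softmax mass of \<open>y\<close> has derivative
  \<open>p\<^sub>u y * (h y - c\<^sub>u)\<close>, where \<open>c\<^sub>u\<close> is the \<open>p\<^sub>u\<close>-mean of \<open>h\<close>. The mean value theorem is applied to the sum of these
  masses weighted by the signs of the increments, which turns the \<open>L\<^sup>1\<close> distance into one scalar
  increment.
\<close>

lemma tv_softmax_le:
  fixes f g :: "'b::finite \<Rightarrow> real"
  assumes "\<And>z. \<bar>f z - g z\<bar> \<le> e"
  shows "tv (softmax f) (softmax g) \<le> e / 2"
proof -
  define h where "h z = f z - g z" for z
  define \<sigma> where "\<sigma> z = sgn (softmax f z - softmax g z)" for z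
  define w where "w u z = exp (g z + u * h z)" for u z
  define Z where "Z u = (\<Sum>z\<in>UNIV. w u z)" for u
  define p where "p u = softmax (\<lambda>z. g z + u * h z)" for u
  define \<phi> where "\<phi> u = (\<Sum>z\<in>UNIV. \<sigma> z * w u z) / Z u" for u
  define \<phi>' where "\<phi>' u = (\<Sum>z\<in>UNIV. \<sigma> z * (p u z * (h z - (\<Sum>x\<in>UNIV. p u x * h x))))" for u
  have Z0: "Z u > 0" for u unfolding Z_def w_def by (intro sum_pos) auto
  have p: "p u z = w u z / Z u" for u z
    by (simp add: p_def softmax_def w_def Z_def)
  have deriv: "DERIV \<phi> u :> \<phi>' u" for u
  proof -
    have "DERIV (\<lambda>u. w u z) u :> w u z * h z" for z
      unfolding w_def by (auto intro!: derivative_eq_intros)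
    then have N: "DERIV (\<lambda>u. \<Sum>z\<in>UNIV. \<sigma> z * w u z) u :> (\<Sum>z\<in>UNIV. \<sigma> z * (w u z * h z))"
      and D: "DERIV Z u :> (\<Sum>z\<in>UNIV. w u z * h z)"
      unfolding Z_def by (auto intro!: DERIV_sum DERIV_cmult)
    have "DERIV \<phi> u :> ((\<Sum>z\<in>UNIV. \<sigma> z * (w u z * h z)) * Z u
        - (\<Sum>z\<in>UNIV. \<sigma> z * w u z) * (\<Sum>z\<in>UNIV. w u z * h z)) / (Z u * Z u)"
      unfolding \<phi>_def using DERIV_divide[OF N D] Z0[of u] by simp
    also have "((\<Sum>z\<in>UNIV. \<sigma> z * (w u z * h z)) * Z u
        - (\<Sum>z\<in>UNIV. \<sigma> z * w u z) * (\<Sum>z\<in>UNIV. w u z * h z)) / (Z u * Z u) = \<phi>' u"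
    proof -
      have "\<phi>' u = (\<Sum>z\<in>UNIV. \<sigma> z * (w u z * h z) / Z u
          - \<sigma> z * w u z / Z u * (\<Sum>x\<in>UNIV. w u x * h x / Z u))"
        unfolding \<phi>'_def p by (intro sum.cong) (auto simp: algebra_simps)
      also have "\<dots> = (\<Sum>z\<in>UNIV. \<sigma> z * (w u z * h z)) / Z u
          - (\<Sum>z\<in>UNIV. \<sigma> z * w u z) / Z u * ((\<Sum>x\<in>UNIV. w u x * h x) / Z u)"
        by (simp only: sum_subtractf flip: sum_divide_distrib sum_distrib_right)
      finally show ?thesis using Z0[of u] by (simp add: field_simps)
    qed
    finally show ?thesis .
  qed
  then obtain u where u: "\<phi> 1 - \<phi> 0 = \<phi>' u"
    using MVT2[of 0 1 \<phi> \<phi>'] by auto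
  have "(\<Sum>z\<in>UNIV. \<bar>softmax f z - softmax g z\<bar>) = \<phi> 1 - \<phi> 0"
    unfolding \<phi>_def
    by (simp add: abs_sgn \<sigma>_def softmax_def w_def Z_def h_def algebra_simps sum_subtractf sum_divide_distrib
        diff_divide_distrib)
  also have "\<dots> \<le> (\<Sum>z\<in>UNIV. p u z * \<bar>h z - (\<Sum>x\<in>UNIV. p u x * h x)\<bar>)"
    unfolding u \<phi>'_def
  proof (intro sum_mono)
    fix z
    have p0: "0 \<le> p u z" by (simp add: p_def softmax_pos less_imp_le)
    have "\<sigma> z * (p u z * (h z - (\<Sum>x\<in>UNIV. p u x * h x)))
        \<le> \<bar>\<sigma> z * (p u z * (h z - (\<Sum>x\<in>UNIV. p u x * h x)))\<bar>"
      by (rule abs_ge_self)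
    also have "\<dots> = \<bar>\<sigma> z\<bar> * (p u z * \<bar>h z - (\<Sum>x\<in>UNIV. p u x * h x)\<bar>)"
      using p0 by (simp only: abs_mult abs_of_nonneg)
    also have "\<dots> \<le> 1 * (p u z * \<bar>h z - (\<Sum>x\<in>UNIV. p u x * h x)\<bar>)"
      using p0 by (intro mult_right_mono mult_nonneg_nonneg) (auto simp: \<sigma>_def abs_sgn_eq)
    finally show "\<sigma> z * (p u z * (h z - (\<Sum>x\<in>UNIV. p u x * h x)))
        \<le> p u z * \<bar>h z - (\<Sum>x\<in>UNIV. p u x * h x)\<bar>" by simp
  qed
  also have "\<dots> \<le> e"
    unfolding p_def by (intro mean_abs_deviation_le prob_vec_softmax) (simp add: h_def assms)
  finally show ?thesis by (simp add: tv_def)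
qed


section \<open>Contraction of stochastic kernels and stability of Bayes' rule\<close>

definition push :: "('s::finite \<Rightarrow> 'b::finite \<Rightarrow> real) \<Rightarrow> ('s \<Rightarrow> real) \<Rightarrow> 'b \<Rightarrow> real" where
  "push K \<mu> z = (\<Sum>s\<in>UNIV. K s z * \<mu> s)"

lemma prob_vec_push:
  assumes "\<And>s. prob_vec (K s)" "prob_vec \<mu>"
  shows "prob_vec (push K \<mu>)"
proof -
  have "(\<Sum>z\<in>UNIV. push K \<mu> z) = (\<Sum>s\<in>UNIV. (\<Sum>z\<in>UNIV. K s z) * \<mu> s)"
    unfolding push_def by (subst sum.swap) (simp flip: sum_distrib_right)
  then show ?thesis
    using assms by (auto simp: prob_vec_def push_def intro!: sum_nonneg)
qed

text \<open>
  Dobrushin's contraction. The positive and negative parts of \<open>\<mu> - \<nu>\<close> have the same mass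
  \<open>\<tau> = tv \<mu> \<nu>\<close>. Coupling them independently writes the difference of the images, multiplied by \<open>\<tau>\<close>, as a
  combination of differences \<open>K s - K s'\<close> with total weight \<open>\<tau>\<^sup>2\<close>.
\<close>

lemma tv_push_le:
  assumes K: "\<And>s. prob_vec (K s)"
    and \<kappa>: "\<And>s s'. \<kappa> \<le> (\<Sum>z\<in>UNIV. min (K s z) (K s' z))"
    and \<mu>: "prob_vec \<mu>" and \<nu>: "prob_vec \<nu>"
  shows "tv (push K \<mu>) (push K \<nu>) \<le> (1 - \<kappa>) * tv \<mu> \<nu>"
proof -
  define \<tau> where "\<tau> = tv \<mu> \<nu>"
  define p where "p s = max 0 (\<mu> s - \<nu> s)" for s
  define n where "n s = max 0 (\<nu> s - \<mu> s)" for s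
  have p0: "0 \<le> p s" and n0: "0 \<le> n s" and pn: "\<mu> s - \<nu> s = p s - n s"
    and pn': "\<bar>\<mu> s - \<nu> s\<bar> = p s + n s" for s
    by (auto simp: p_def n_def)
  have "(\<Sum>s\<in>UNIV. p s) - (\<Sum>s\<in>UNIV. n s) = 0"
    using \<mu> \<nu> by (simp add: prob_vec_def flip: sum_subtractf pn) (simp add: sum_subtractf)
  moreover have "(\<Sum>s\<in>UNIV. p s) + (\<Sum>s\<in>UNIV. n s) = 2 * \<tau>"
    by (simp add: \<tau>_def tv_def pn' sum.distrib)
  ultimately have sp: "(\<Sum>s\<in>UNIV. p s) = \<tau>" and sn: "(\<Sum>s\<in>UNIV. n s) = \<tau>" by auto
  have diff: "\<tau> * (push K \<mu> z - push K \<nu> z)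
      = (\<Sum>s\<in>UNIV. \<Sum>s'\<in>UNIV. p s * n s' * (K s z - K s' z))" for z
  proof -
    have "(\<Sum>s\<in>UNIV. \<Sum>s'\<in>UNIV. p s * n s' * (K s z - K s' z))
        = (\<Sum>s\<in>UNIV. \<Sum>s'\<in>UNIV. (p s * K s z) * n s') - (\<Sum>s\<in>UNIV. \<Sum>s'\<in>UNIV. p s * (n s' * K s' z))"
      by (simp add: algebra_simps sum_subtractf)
    also have "\<dots> = \<tau> * (\<Sum>s\<in>UNIV. p s * K s z) - \<tau> * (\<Sum>s\<in>UNIV. n s * K s z)"
      by (simp add: sp sn flip: sum_distrib_left sum_distrib_right)
    also have "\<dots> = \<tau> * (\<Sum>s\<in>UNIV. K s z * (p s - n s))"
      by (simp add: algebra_simps sum_subtractf)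
    finally show ?thesis
      by (simp add: push_def pn[symmetric] algebra_simps sum_subtractf)
  qed
  have "0 \<le> \<tau>" by (simp add: \<tau>_def tv_nonneg)
  have "\<tau> * (2 * tv (push K \<mu>) (push K \<nu>)) = \<tau> * (\<Sum>z\<in>UNIV. \<bar>push K \<mu> z - push K \<nu> z\<bar>)"
    by (simp add: tv_def)
  also have "\<dots> = (\<Sum>z\<in>UNIV. \<bar>\<tau> * (push K \<mu> z - push K \<nu> z)\<bar>)"
    using \<open>0 \<le> \<tau>\<close> by (simp add: abs_mult sum_distrib_left)
  also have "\<dots> \<le> (\<Sum>z\<in>UNIV. \<Sum>s\<in>UNIV. \<Sum>s'\<in>UNIV. p s * n s' * \<bar>K s z - K s' z\<bar>)"
  proof (intro sum_mono)
    fix z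
    show "\<bar>\<tau> * (push K \<mu> z - push K \<nu> z)\<bar> \<le> (\<Sum>s\<in>UNIV. \<Sum>s'\<in>UNIV. p s * n s' * \<bar>K s z - K s' z\<bar>)"
      unfolding diff using p0 n0
      by (intro order_trans[OF sum_abs] sum_mono) (simp add: abs_mult)
  qed
  also have "\<dots> = (\<Sum>s\<in>UNIV. \<Sum>s'\<in>UNIV. p s * n s' * (2 * tv (K s) (K s')))"
    by (subst sum.swap, rule sum.cong[OF refl], subst sum.swap)
      (simp add: tv_def flip: sum_distrib_left)
  also have "\<dots> \<le> (\<Sum>s\<in>UNIV. \<Sum>s'\<in>UNIV. p s * n s' * (2 * (1 - \<kappa>)))"
    using p0 n0 \<kappa> by (intro sum_mono mult_left_mono) (auto simp: tv_eq_overlap[OF K K])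
  also have "\<dots> = \<tau> * (2 * ((1 - \<kappa>) * \<tau>))"
    by (simp add: sp sn flip: sum_distrib_left sum_distrib_right)
  finally have main: "\<tau> * (2 * tv (push K \<mu>) (push K \<nu>)) \<le> \<tau> * (2 * ((1 - \<kappa>) * \<tau>))" .
  show ?thesis
  proof (cases "\<tau> = 0")
    case True
    then have "\<mu> s = \<nu> s" for s
      using pn'[of s] sum_nonneg_eq_0_iff[of UNIV p] sum_nonneg_eq_0_iff[of UNIV n] p0 n0 sp sn by simp
    then have "\<mu> = \<nu>" by auto
    then show ?thesis by (simp add: tv_def)
  next
    case False
    then have "\<tau> > 0" using \<open>0 \<le> \<tau>\<close> by simp
    then show ?thesis using main by (simp add: \<tau>_def)
  qed
qed

lemma tv_push_perturb_le:
  assumes K: "\<And>s. prob_vec (K s)"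
    and \<kappa>: "\<And>s s'. \<kappa> \<le> (\<Sum>z\<in>UNIV. min (K s z) (K s' z))"
    and e: "\<And>s. tv (K s) (K' s) \<le> e"
    and \<mu>: "prob_vec \<mu>" and \<nu>: "prob_vec \<nu>"
  shows "tv (push K \<mu>) (push K' \<nu>) \<le> (1 - \<kappa>) * tv \<mu> \<nu> + e"
proof -
  have \<nu>0: "0 \<le> \<nu> s" and \<nu>1: "(\<Sum>s\<in>UNIV. \<nu> s) = 1" for s
    using \<nu> by (auto simp: prob_vec_def)
  have "(\<Sum>z\<in>UNIV. \<bar>push K \<nu> z - push K' \<nu> z\<bar>) \<le> (\<Sum>z\<in>UNIV. \<Sum>s\<in>UNIV. \<bar>K s z - K' s z\<bar> * \<nu> s)"
  proof (intro sum_mono)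
    fix z
    have "\<bar>push K \<nu> z - push K' \<nu> z\<bar> = \<bar>\<Sum>s\<in>UNIV. (K s z - K' s z) * \<nu> s\<bar>"
      by (simp add: push_def algebra_simps sum_subtractf)
    also have "\<dots> \<le> (\<Sum>s\<in>UNIV. \<bar>K s z - K' s z\<bar> * \<nu> s)"
      using \<nu>0 by (intro order_trans[OF sum_abs] sum_mono) (simp add: abs_mult)
    finally show "\<bar>push K \<nu> z - push K' \<nu> z\<bar> \<le> (\<Sum>s\<in>UNIV. \<bar>K s z - K' s z\<bar> * \<nu> s)" .
  qed
  also have "\<dots> = (\<Sum>s\<in>UNIV. 2 * tv (K s) (K' s) * \<nu> s)"
    by (subst sum.swap) (simp add: tv_def flip: sum_distrib_right)
  also have "\<dots> \<le> (\<Sum>s\<in>UNIV. 2 * e * \<nu> s)"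
    using e \<nu>0 by (intro sum_mono mult_right_mono) auto
  also have "\<dots> = 2 * e"
    by (simp add: \<nu>1 flip: sum_distrib_left)
  finally have "tv (push K \<nu>) (push K' \<nu>) \<le> e" by (simp add: tv_def)
  then show ?thesis
    using tv_push_le[where K = K, OF K \<kappa> \<mu> \<nu>] tv_triangle[of "push K \<mu>" "push K' \<nu>" "push K \<nu>"] by linarith
qed

definition bayes :: "('s::finite \<Rightarrow> 'o \<Rightarrow> real) \<Rightarrow> ('s \<Rightarrow> real) \<Rightarrow> 'o \<Rightarrow> 's \<Rightarrow> real" where
  "bayes L \<mu> u s = L s u * \<mu> s / (\<Sum>z\<in>UNIV. L z u * \<mu> z)"

lemma marginal_pos:
  fixes L :: "'s::finite \<Rightarrow> 'o \<Rightarrow> real"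
  assumes "\<And>s u. 0 < L s u" "prob_vec \<mu>"
  shows "0 < (\<Sum>z\<in>UNIV. L z u * \<mu> z)"
proof -
  have "\<exists>z. \<mu> z \<noteq> 0"
    using assms(2) by (auto simp: prob_vec_def intro: ccontr)
  then obtain z where z: "0 < \<mu> z"
    using assms(2) by (auto simp: prob_vec_def less_le)
  have "0 < L z u * \<mu> z" using z assms(1) by simp
  also have "\<dots> \<le> (\<Sum>z\<in>UNIV. L z u * \<mu> z)"
    using assms by (intro member_le_sum) (auto simp: prob_vec_def less_imp_le)
  finally show ?thesis .
qed

lemma prob_vec_bayes:
  assumes "\<And>s u. 0 < L s u" "prob_vec \<mu>"
  shows "prob_vec (bayes L \<mu> u)"
proof -
  have "0 < (\<Sum>z\<in>UNIV. L z u * \<mu> z)" using marginal_pos[of L \<mu> u] assms by blast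
  then show ?thesis
    using assms by (auto simp: prob_vec_def bayes_def less_imp_le simp flip: sum_divide_distrib)
qed

text \<open>
  With joint masses \<open>J = L s u * \<mu> s\<close>, \<open>J' = L' s u * \<nu> s\<close> and marginals \<open>m\<close>, \<open>m'\<close>, insert \<open>J\<close> between
  \<open>m' * (J / m)\<close> and \<open>J'\<close>. The first difference sums over states to \<open>\<bar>m' - m\<bar>\<close>, the distance of the
  laws of the observation, and the second one to the distance of the joint laws. The former is controlled by
  Dobrushin's contraction of \<open>L\<close>, the latter only by \<open>tv \<mu> \<nu> + e\<close>, whence the factor \<open>2 - \<kappa>\<close>.
\<close>

lemma bayes_stability:
  fixes L L' :: "'s::finite \<Rightarrow> 'o::finite \<Rightarrow> real"
  assumes L: "\<And>s. prob_vec (L s)" and Lpos: "\<And>s u. 0 < L s u"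
    and L': "\<And>s. prob_vec (L' s)" and Lpos': "\<And>s u. 0 < L' s u"
    and \<kappa>: "\<And>s s'. \<kappa> \<le> (\<Sum>u\<in>UNIV. min (L s u) (L s' u))"
    and e: "\<And>s. tv (L s) (L' s) \<le> e"
    and \<mu>: "prob_vec \<mu>" and \<nu>: "prob_vec \<nu>"
  shows "(\<Sum>u\<in>UNIV. push L' \<nu> u * tv (bayes L \<mu> u) (bayes L' \<nu> u))
    \<le> (2 - \<kappa>) * tv \<mu> \<nu> + 2 * e"
proof -
  define J where "J u s = L s u * \<mu> s" for u s
  define J' where "J' u s = L' s u * \<nu> s" for u s
  have m: "0 < push L \<mu> u" and m': "0 < push L' \<nu> u" for u
    using marginal_pos[OF Lpos \<mu>] marginal_pos[OF Lpos' \<nu>] by (auto simp: push_def)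
  have b: "bayes L \<mu> u s = J u s / push L \<mu> u" "bayes L' \<nu> u s = J' u s / push L' \<nu> u" for u s
    by (auto simp: bayes_def push_def J_def J'_def)
  have J0: "0 \<le> J u s" for u s
    using Lpos \<mu> by (auto simp: J_def prob_vec_def less_imp_le)
  have \<nu>0: "0 \<le> \<nu> s" for s using \<nu> by (auto simp: prob_vec_def)
  have Jsum: "(\<Sum>s\<in>UNIV. J u s) = push L \<mu> u" for u
    by (simp add: J_def push_def)
  have pt: "push L' \<nu> u * \<bar>bayes L \<mu> u s - bayes L' \<nu> u s\<bar>
      \<le> \<bar>push L \<mu> u - push L' \<nu> u\<bar> * (J u s / push L \<mu> u) + \<bar>J u s - J' u s\<bar>" for u s
  proof -
    have "push L' \<nu> u * \<bar>bayes L \<mu> u s - bayes L' \<nu> u s\<bar>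
        = \<bar>push L' \<nu> u * (bayes L \<mu> u s - bayes L' \<nu> u s)\<bar>"
      using m'[of u] by (simp add: abs_mult)
    also have "push L' \<nu> u * (bayes L \<mu> u s - bayes L' \<nu> u s)
        = - ((push L \<mu> u - push L' \<nu> u) * (J u s / push L \<mu> u)) + (J u s - J' u s)"
      using m[of u] m'[of u] by (simp add: b field_simps)
    also have "\<bar>\<dots>\<bar> \<le> \<bar>(push L \<mu> u - push L' \<nu> u) * (J u s / push L \<mu> u)\<bar> + \<bar>J u s - J' u s\<bar>"
      by linarith
    finally show ?thesis
      using m[of u] J0[of u s] by (simp add: abs_mult)
  qed
  have "2 * (\<Sum>u\<in>UNIV. push L' \<nu> u * tv (bayes L \<mu> u) (bayes L' \<nu> u))
      = (\<Sum>u\<in>UNIV. \<Sum>s\<in>UNIV. push L' \<nu> u * \<bar>bayes L \<mu> u s - bayes L' \<nu> u s\<bar>)"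
    by (simp add: tv_def sum_distrib_left mult_ac)
  also have "\<dots> \<le> (\<Sum>u\<in>UNIV. \<Sum>s\<in>UNIV.
      \<bar>push L \<mu> u - push L' \<nu> u\<bar> * (J u s / push L \<mu> u) + \<bar>J u s - J' u s\<bar>)"
    by (intro sum_mono pt)
  also have "\<dots> = (\<Sum>u\<in>UNIV. \<bar>push L \<mu> u - push L' \<nu> u\<bar>) + (\<Sum>u\<in>UNIV. \<Sum>s\<in>UNIV. \<bar>J u s - J' u s\<bar>)"
    using m by (simp add: sum.distrib Jsum less_imp_neq[symmetric] flip: sum_distrib_left sum_divide_distrib)
  also have "(\<Sum>u\<in>UNIV. \<bar>push L \<mu> u - push L' \<nu> u\<bar>) \<le> 2 * ((1 - \<kappa>) * tv \<mu> \<nu> + e)"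
    using tv_push_perturb_le[where K = L and K' = L', OF L \<kappa> e \<mu> \<nu>] by (simp add: tv_def)
  also have "(\<Sum>u\<in>UNIV. \<Sum>s\<in>UNIV. \<bar>J u s - J' u s\<bar>) \<le> 2 * (tv \<mu> \<nu> + e)"
  proof -
    have "(\<Sum>u\<in>UNIV. \<Sum>s\<in>UNIV. \<bar>J u s - J' u s\<bar>)
        \<le> (\<Sum>u\<in>UNIV. \<Sum>s\<in>UNIV. L s u * \<bar>\<mu> s - \<nu> s\<bar> + \<bar>L s u - L' s u\<bar> * \<nu> s)"
    proof (intro sum_mono)
      fix u s
      have "J u s - J' u s = L s u * (\<mu> s - \<nu> s) + (L s u - L' s u) * \<nu> s"
        by (simp add: J_def J'_def algebra_simps)
      then show "\<bar>J u s - J' u s\<bar> \<le> L s u * \<bar>\<mu> s - \<nu> s\<bar> + \<bar>L s u - L' s u\<bar> * \<nu> s"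
        using Lpos[of s u] \<nu>0[of s] abs_triangle_ineq[of "L s u * (\<mu> s - \<nu> s)" "(L s u - L' s u) * \<nu> s"]
        by (simp add: abs_mult)
    qed
    also have "\<dots> = (\<Sum>s\<in>UNIV. (\<Sum>u\<in>UNIV. L s u) * \<bar>\<mu> s - \<nu> s\<bar>) + (\<Sum>s\<in>UNIV. 2 * tv (L s) (L' s) * \<nu> s)"
      by (subst sum.swap) (simp add: sum.distrib tv_def flip: sum_distrib_right)
    also have "\<dots> \<le> (\<Sum>s\<in>UNIV. \<bar>\<mu> s - \<nu> s\<bar>) + (\<Sum>s\<in>UNIV. 2 * e * \<nu> s)"
      using L e \<nu>0 by (intro add_mono sum_mono mult_right_mono) (auto simp: prob_vec_def)
    also have "\<dots> = 2 * (tv \<mu> \<nu> + e)"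
      using \<nu> by (simp add: tv_def prob_vec_def flip: sum_distrib_left)
    finally show ?thesis .
  qed
  finally show ?thesis by (simp add: algebra_simps)
qed

section \<open>The belief is the conditional law of the state\<close>

lemma belief_Suc_eq_bayes:
  "belief P \<Phi> \<nu>0 a y (Suc k)
    = bayes \<Phi> (push (\<lambda>s. P s (a k)) (belief P \<Phi> \<nu>0 a y k)) (y (Suc k))"
  by (simp add: bayes_def push_def fun_eq_iff)

lemma belief_cong:
  assumes "\<And>j. 1 \<le> j \<Longrightarrow> j \<le> k \<Longrightarrow> y j = y' j"
  shows "belief P \<Phi> \<nu>0 a y k = belief P \<Phi> \<nu>0 a y' k"
  using assms by (induction k) (simp_all del: belief.simps(2) add: belief_Suc_eq_bayes)

lemma prob_vec_belief:
  assumes "\<And>s a. prob_vec (P s a)" "\<And>s u. 0 < \<Phi> s u"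
  shows "prob_vec (belief P \<Phi> \<nu>0 a y k)"
proof (induction k)
  case (Suc k)
  then show ?case
    unfolding belief_Suc_eq_bayes by (intro prob_vec_bayes prob_vec_push assms)
qed (simp add: prob_vec_pmf)

lemma expectation_bind_finite:
  fixes h :: "'b \<Rightarrow> real"
  assumes "finite (set_pmf p)" "\<And>x. finite (set_pmf (f x))"
  shows "measure_pmf.expectation (bind_pmf p f) h
    = measure_pmf.expectation p (\<lambda>x. measure_pmf.expectation (f x) h)"
  using assms
  by (subst pmf_expectation_bind[of "set_pmf p"]) (auto simp: integral_measure_pmf[of "set_pmf p"])

lemma expectation_finite_type:
  fixes h :: "'b::finite \<Rightarrow> real"
  shows "measure_pmf.expectation p h = (\<Sum>x\<in>UNIV. pmf p x * h x)"
  by (subst integral_measure_pmf[of UNIV]) auto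

lemma finite_joint_law:
  fixes P :: "'s::finite \<Rightarrow> 'a \<Rightarrow> 's pmf" and \<Phi> :: "'s \<Rightarrow> ('o::finite) pmf"
  shows "finite (set_pmf (joint_law P \<Phi> \<nu>0 a k))"
  by (induction k) (auto simp: case_prod_beta)

lemma expectation_joint_law_Suc:
  fixes P :: "'s::finite \<Rightarrow> 'a \<Rightarrow> 's pmf" and \<Phi> :: "'s \<Rightarrow> ('o::finite) pmf"
    and f :: "'s \<times> (nat \<Rightarrow> 'o) \<Rightarrow> real"
  shows "measure_pmf.expectation (joint_law P \<Phi> \<nu>0 a (Suc k)) f
    = measure_pmf.expectation (joint_law P \<Phi> \<nu>0 a k)
        (\<lambda>(s, y). \<Sum>s'\<in>UNIV. pmf (P s (a k)) s' * (\<Sum>u\<in>UNIV. pmf (\<Phi> s') u * f (s', y(Suc k := u))))"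
  by (simp add: expectation_bind_finite finite_joint_law case_prod_unfold expectation_finite_type)

text \<open>
  Under the true law, the observations up to time \<open>k\<close> determine the conditional law of the
  state: it is the true belief. In the inductive step, \<open>m\<close> below is the conditional probability of
  the next observation \<open>u\<close>. It cancels the normalization of the belief, which is possible because
  the observation kernel is positive.
\<close>

lemma filtering_property:
  fixes P :: "'s::finite \<Rightarrow> 'a \<Rightarrow> 's pmf" and \<Phi> :: "'s \<Rightarrow> ('o::finite) pmf"
    and \<nu>0 :: "'s pmf" and a :: "nat \<Rightarrow> 'a" and f :: "'s \<times> (nat \<Rightarrow> 'o) \<Rightarrow> real"
  assumes pos: "\<And>s u. 0 < pmf (\<Phi> s) u"
  defines "b \<equiv> belief (\<lambda>s a. pmf (P s a)) (\<lambda>s. pmf (\<Phi> s)) \<nu>0 a"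
  shows "measure_pmf.expectation (joint_law P \<Phi> \<nu>0 a k) f
    = measure_pmf.expectation (joint_law P \<Phi> \<nu>0 a k) (\<lambda>(s, y). \<Sum>s\<in>UNIV. b y k s * f (s, y))"
proof (induction k arbitrary: f)
  case 0
  show ?case
    by (simp add: b_def integral_map_pmf expectation_finite_type sum_distrib_right[symmetric]
        sum_pmf_eq_1)
next
  case (Suc k)
  define \<pi> where "\<pi> y = push (\<lambda>s. pmf (P s (a k))) (b y k)" for y
  have \<pi>: "prob_vec (\<pi> y)" for y
    unfolding \<pi>_def b_def by (intro prob_vec_push prob_vec_belief prob_vec_pmf pos)
  have b_Suc: "b (y(Suc k := u)) (Suc k) = bayes (\<lambda>s. pmf (\<Phi> s)) (\<pi> y) u" for y u
  proof -
    have "b (y(Suc k := u)) k = b y k"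
      unfolding b_def by (rule belief_cong) auto
    then show ?thesis
      by (simp add: \<pi>_def b_def belief_Suc_eq_bayes del: belief.simps(2))
  qed
  have step: "measure_pmf.expectation (joint_law P \<Phi> \<nu>0 a (Suc k)) g
    = measure_pmf.expectation (joint_law P \<Phi> \<nu>0 a k)
        (\<lambda>(s, y). \<Sum>u\<in>UNIV. \<Sum>s'\<in>UNIV. pmf (\<Phi> s') u * \<pi> y s' * g (s', y(Suc k := u)))"
    for g :: "'s \<times> (nat \<Rightarrow> 'o) \<Rightarrow> real"
  proof -
    have "(\<Sum>s\<in>UNIV. b y k s * (\<Sum>s'\<in>UNIV. pmf (P s (a k)) s' * G s'))
        = (\<Sum>s'\<in>UNIV. \<pi> y s' * G s')" for y and G :: "'s \<Rightarrow> real"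
      unfolding \<pi>_def push_def sum_distrib_left sum_distrib_right
      by (subst sum.swap) (simp add: mult_ac)
    moreover have "(\<Sum>s'\<in>UNIV. \<pi> y s' * (\<Sum>u\<in>UNIV. pmf (\<Phi> s') u * g (s', y(Suc k := u))))
        = (\<Sum>u\<in>UNIV. \<Sum>s'\<in>UNIV. pmf (\<Phi> s') u * \<pi> y s' * g (s', y(Suc k := u)))" for y
      unfolding sum_distrib_left by (subst sum.swap) (simp add: mult_ac)
    ultimately show ?thesis
      by (simp only: expectation_joint_law_Suc) (subst Suc.IH, simp)
  qed
  have cancel: "(\<Sum>s'\<in>UNIV. pmf (\<Phi> s') u * \<pi> y s' * G s')
      = (\<Sum>s'\<in>UNIV. pmf (\<Phi> s') u * \<pi> y s' * (\<Sum>s\<in>UNIV. bayes (\<lambda>s. pmf (\<Phi> s)) (\<pi> y) u s * G s))"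
    for y u and G :: "'s \<Rightarrow> real"
  proof -
    define m where "m = (\<Sum>s'\<in>UNIV. pmf (\<Phi> s') u * \<pi> y s')"
    have "0 < m"
      unfolding m_def using pos by (intro marginal_pos \<pi>) auto
    then show ?thesis
      by (simp add: bayes_def flip: sum_distrib_right m_def) (simp add: sum_distrib_left)
  qed
  show ?case
    unfolding step by (simp add: b_Suc) (subst cancel, rule refl)
qed


section \<open>Propagation of the belief error\<close>

text \<open>
  One step of the recursion conditions on the past: given \<open>y\<close>, the next observation has law
  \<open>push \<Phi> \<pi>'\<close> with \<open>\<pi>'\<close> the true predicted law of the state, which is the law that \<open>bayes_stability\<close>
  averages over.
\<close>

lemma expected_belief_error_Suc:
  fixes P :: "'s::finite \<Rightarrow> 'a \<Rightarrow> 's pmf" and \<Phi> :: "'s \<Rightarrow> ('o::finite) pmf"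
    and K :: "'s \<Rightarrow> 'a \<Rightarrow> 's \<Rightarrow> real" and L :: "'s \<Rightarrow> 'o \<Rightarrow> real"
    and \<nu>0 :: "'s pmf" and a :: "nat \<Rightarrow> 'a"
  assumes pos: "\<And>s u. 0 < pmf (\<Phi> s) u"
    and K: "\<And>s a. prob_vec (K s a)"
    and L: "\<And>s. prob_vec (L s)" and Lpos: "\<And>s u. 0 < L s u"
    and \<kappa>P: "\<And>a s s'. \<kappa>P \<le> (\<Sum>z\<in>UNIV. min (K s a z) (K s' a z))"
    and \<kappa>L: "\<And>s s'. \<kappa>L \<le> (\<Sum>u\<in>UNIV. min (L s u) (L s' u))" and "\<kappa>L \<le> 1"
    and eP: "\<And>s a. tv (K s a) (pmf (P s a)) \<le> eP"
    and eL: "\<And>s. tv (L s) (pmf (\<Phi> s)) \<le> eL"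
  defines "err k y \<equiv> tv (belief K L \<nu>0 a y k)
      (belief (\<lambda>s a. pmf (P s a)) (\<lambda>s. pmf (\<Phi> s)) \<nu>0 a y k)"
  shows "measure_pmf.expectation (joint_law P \<Phi> \<nu>0 a (Suc k)) (\<lambda>(s, y). err (Suc k) y)
    \<le> (2 - \<kappa>L) * (1 - \<kappa>P) * measure_pmf.expectation (joint_law P \<Phi> \<nu>0 a k) (\<lambda>(s, y). err k y)
       + (2 * eL + (2 - \<kappa>L) * eP)"
proof -
  let ?J = "joint_law P \<Phi> \<nu>0 a k"
  define b where "b y = belief K L \<nu>0 a y k" for y
  define b' where "b' y = belief (\<lambda>s a. pmf (P s a)) (\<lambda>s. pmf (\<Phi> s)) \<nu>0 a y k" for y
  define \<pi> where "\<pi> y = push (\<lambda>s. K s (a k)) (b y)" for y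
  define \<pi>' where "\<pi>' y = push (\<lambda>s. pmf (P s (a k))) (b' y)" for y
  define T where "T y u = tv (bayes L (\<pi> y) u) (bayes (\<lambda>s. pmf (\<Phi> s)) (\<pi>' y) u)" for y u
  have b: "prob_vec (b y)" and b': "prob_vec (b' y)" for y
    unfolding b_def b'_def by (intro prob_vec_belief prob_vec_pmf K Lpos pos)+
  have \<pi>: "prob_vec (\<pi> y)" and \<pi>': "prob_vec (\<pi>' y)" for y
    unfolding \<pi>_def \<pi>'_def by (intro prob_vec_push prob_vec_pmf K b b')+
  have err_Suc: "err (Suc k) (y(Suc k := u)) = T y u" for y u
  proof -
    have "belief K L \<nu>0 a (y(Suc k := u)) k = b y"
      and "belief (\<lambda>s a. pmf (P s a)) (\<lambda>s. pmf (\<Phi> s)) \<nu>0 a (y(Suc k := u)) k = b' y"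
      unfolding b_def b'_def by (rule belief_cong; simp)+
    then show ?thesis
      by (simp add: err_def T_def \<pi>_def \<pi>'_def belief_Suc_eq_bayes del: belief.simps(2))
  qed
  have err_k: "err k y = tv (b y) (b' y)" for y
    by (simp add: err_def b_def b'_def)
  have one_step: "(\<Sum>u\<in>UNIV. push (\<lambda>s. pmf (\<Phi> s)) (\<pi>' y) u * T y u)
      \<le> (2 - \<kappa>L) * (1 - \<kappa>P) * err k y + (2 * eL + (2 - \<kappa>L) * eP)" for y
  proof -
    have "tv (\<pi> y) (\<pi>' y) \<le> (1 - \<kappa>P) * err k y + eP"
      unfolding \<pi>_def \<pi>'_def err_k by (intro tv_push_perturb_le K \<kappa>P eP b b')
    then have "(2 - \<kappa>L) * tv (\<pi> y) (\<pi>' y) \<le> (2 - \<kappa>L) * ((1 - \<kappa>P) * err k y + eP)"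
      using \<open>\<kappa>L \<le> 1\<close> by (intro mult_left_mono) auto
    moreover have "(\<Sum>u\<in>UNIV. push (\<lambda>s. pmf (\<Phi> s)) (\<pi>' y) u * T y u)
        \<le> (2 - \<kappa>L) * tv (\<pi> y) (\<pi>' y) + 2 * eL"
      unfolding T_def by (intro bayes_stability L Lpos pos prob_vec_pmf \<kappa>L eL \<pi> \<pi>')
    ultimately show ?thesis by (simp add: algebra_simps)
  qed
  have "measure_pmf.expectation (joint_law P \<Phi> \<nu>0 a (Suc k)) (\<lambda>(s, y). err (Suc k) y)
      = measure_pmf.expectation ?J (\<lambda>(s, y). \<Sum>s'\<in>UNIV. pmf (P s (a k)) s' * (\<Sum>u\<in>UNIV. pmf (\<Phi> s') u * T y u))"
    by (simp only: expectation_joint_law_Suc prod.case err_Suc)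
  also have "\<dots> = measure_pmf.expectation ?J (\<lambda>(s, y). \<Sum>u\<in>UNIV. push (\<lambda>s. pmf (\<Phi> s)) (\<pi>' y) u * T y u)"
  proof -
    have 1: "(\<Sum>s\<in>UNIV. b' y s * (\<Sum>s'\<in>UNIV. pmf (P s (a k)) s' * G s'))
        = (\<Sum>s'\<in>UNIV. \<pi>' y s' * G s')" for y and G :: "'s \<Rightarrow> real"
      unfolding \<pi>'_def push_def sum_distrib_left sum_distrib_right
      by (subst sum.swap) (simp add: mult_ac)
    have 2: "(\<Sum>s'\<in>UNIV. \<pi>' y s' * (\<Sum>u\<in>UNIV. pmf (\<Phi> s') u * T y u))
        = (\<Sum>u\<in>UNIV. push (\<lambda>s. pmf (\<Phi> s)) (\<pi>' y) u * T y u)" for y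
      unfolding push_def sum_distrib_left sum_distrib_right by (subst sum.swap) (simp add: mult_ac)
    show ?thesis
      by (subst filtering_property[OF pos]) (simp add: 1 2 flip: b'_def)
  qed
  also have "\<dots> \<le> measure_pmf.expectation ?J
      (\<lambda>(s, y). (2 - \<kappa>L) * (1 - \<kappa>P) * err k y + (2 * eL + (2 - \<kappa>L) * eP))"
    using one_step
    by (intro integral_mono integrable_measure_pmf_finite finite_joint_law) auto
  also have "\<dots> = (2 - \<kappa>L) * (1 - \<kappa>P) * measure_pmf.expectation ?J (\<lambda>(s, y). err k y)
       + (2 * eL + (2 - \<kappa>L) * eP)"
    by (simp add: case_prod_unfold integrable_measure_pmf_finite finite_joint_law)
  finally show ?thesis .
qed

text \<open>
  The recursion has contraction factor \<open>(2 - \<kappa>L) * (1 - \<kappa>P)\<close> and noise \<open>2 * eL + (2 - \<kappa>L) * eP\<close>. Since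
  \<open>\<kappa>L \<le> 1\<close>, one has \<open>2 - \<kappa>L \<le> 3 - 2 * \<kappa>L \<le> 4 - 3 * \<kappa>L\<close>, which gives the constants below.
\<close>

lemma expected_belief_error_le:
  fixes P :: "'s::finite \<Rightarrow> 'a \<Rightarrow> 's pmf" and \<Phi> :: "'s \<Rightarrow> ('o::finite) pmf"
    and K :: "'s \<Rightarrow> 'a \<Rightarrow> 's \<Rightarrow> real" and L :: "'s \<Rightarrow> 'o \<Rightarrow> real"
    and \<nu>0 :: "'s pmf" and a :: "nat \<Rightarrow> 'a"
  assumes pos: "\<And>s u. 0 < pmf (\<Phi> s) u"
    and K: "\<And>s a. prob_vec (K s a)"
    and L: "\<And>s. prob_vec (L s)" and Lpos: "\<And>s u. 0 < L s u"
    and \<kappa>P: "\<And>a s s'. \<kappa>P \<le> (\<Sum>z\<in>UNIV. min (K s a z) (K s' a z))" and "\<kappa>P \<le> 1"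
    and \<kappa>L: "\<And>s s'. \<kappa>L \<le> (\<Sum>u\<in>UNIV. min (L s u) (L s' u))" and "\<kappa>L \<le> 1"
    and eP: "\<And>s a. tv (K s a) (pmf (P s a)) \<le> eP"
    and eL: "\<And>s. tv (L s) (pmf (\<Phi> s)) \<le> eL"
  defines "\<alpha> \<equiv> (1 - \<kappa>P) * (4 - 3 * \<kappa>L)"
  assumes "\<alpha> < 1"
  shows "measure_pmf.expectation (obs_law P \<Phi> \<nu>0 a t)
      (\<lambda>y. tv (belief K L \<nu>0 a y t) (belief (\<lambda>s a. pmf (P s a)) (\<lambda>s. pmf (\<Phi> s)) \<nu>0 a y t))
    \<le> (1 - \<alpha> ^ t) / (1 - \<alpha>) * (2 * eL + (3 - 2 * \<kappa>L) * eP)"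
proof -
  define E where "E k = measure_pmf.expectation (joint_law P \<Phi> \<nu>0 a k) (\<lambda>(s, y).
      tv (belief K L \<nu>0 a y k) (belief (\<lambda>s a. pmf (P s a)) (\<lambda>s. pmf (\<Phi> s)) \<nu>0 a y k))" for k
  define c where "c = 2 * eL + (3 - 2 * \<kappa>L) * eP"
  have E0: "0 \<le> E k" for k
    unfolding E_def by (intro integral_nonneg_AE) (auto simp: tv_nonneg)
  have "0 \<le> eP" using eP[of undefined undefined] tv_nonneg order_trans by blast
  have "0 \<le> \<alpha>" using \<open>\<kappa>P \<le> 1\<close> \<open>\<kappa>L \<le> 1\<close> by (simp add: \<alpha>_def)
  have rec: "E (Suc k) \<le> \<alpha> * E k + c" for k
  proof -
    have "E (Suc k) \<le> (2 - \<kappa>L) * (1 - \<kappa>P) * E k + (2 * eL + (2 - \<kappa>L) * eP)"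
      unfolding E_def by (intro expected_belief_error_Suc assms)
    also have "\<dots> \<le> \<alpha> * E k + c"
      unfolding \<alpha>_def c_def mult.commute[of "1 - \<kappa>P"]
      using E0[of k] \<open>0 \<le> eP\<close> \<open>\<kappa>P \<le> 1\<close> \<open>\<kappa>L \<le> 1\<close>
      by (intro add_mono mult_right_mono order_refl) auto
    finally show ?thesis .
  qed
  have "E k \<le> (1 - \<alpha> ^ k) / (1 - \<alpha>) * c" for k
  proof (induction k)
    case 0
    show ?case by (simp add: E_def tv_def)
  next
    case (Suc k)
    have "E (Suc k) \<le> \<alpha> * ((1 - \<alpha> ^ k) / (1 - \<alpha>) * c) + c"
      using rec[of k] mult_left_mono[OF Suc \<open>0 \<le> \<alpha>\<close>] by linarith
    also have "\<dots> = (1 - \<alpha> ^ Suc k) / (1 - \<alpha>) * c"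
      using \<open>\<alpha> < 1\<close> by (simp add: field_simps)
    finally show ?case .
  qed
  moreover have "measure_pmf.expectation (obs_law P \<Phi> \<nu>0 a t)
      (\<lambda>y. tv (belief K L \<nu>0 a y t) (belief (\<lambda>s a. pmf (P s a)) (\<lambda>s. pmf (\<Phi> s)) \<nu>0 a y t)) = E t"
    by (simp add: E_def obs_law_def case_prod_unfold)
  ultimately show ?thesis by (simp add: c_def)
qed


section \<open>Neural kernels on the linearization event\<close>

lemma frob_inner_le: "\<bar>frob_inner m V W\<bar> \<le> frob_norm m V * frob_norm m W"
proof -
  have "\<bar>frob_inner m V W\<bar> \<le> (\<Sum>i<m. \<bar>norm (V i)\<bar> * \<bar>norm (W i)\<bar>)"
    unfolding frob_inner_def
    by (intro order_trans[OF sum_abs] sum_mono) (simp add: Cauchy_Schwarz_ineq2)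
  also have "\<dots> \<le> L2_set (\<lambda>i. norm (V i)) {..<m} * L2_set (\<lambda>i. norm (W i)) {..<m}"
    by (rule L2_set_mult_ineq)
  finally show ?thesis
    by (simp add: L2_set_def frob_norm_def frob_inner_def power2_norm_eq_inner)
qed

lemma frob_norm_nonneg: "0 \<le> frob_norm m W"
  by (auto simp: frob_norm_def frob_inner_def intro!: sum_nonneg)

lemma score_diff_le:
  assumes "\<bar>score m c W x - lin_score \<rho> m c W0 W x\<bar> \<le> e"
    and "\<bar>score m c W' x - lin_score \<rho> m c W0 W' x\<bar> \<le> e"
    and "frob_norm m (tangent \<rho> m c W0 x) \<le> B"
  shows "\<bar>score m c W x - score m c W' x\<bar> \<le> B * frob_norm m (wdiff W W') + 2 * e"
proof -
  have "lin_score \<rho> m c W0 W x - lin_score \<rho> m c W0 W' x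
      = frob_inner m (tangent \<rho> m c W0 x) (wdiff W W')"
    by (simp add: lin_score_def frob_inner_def wdiff_def inner_diff_right sum_subtractf)
  also have "\<bar>\<dots>\<bar> \<le> B * frob_norm m (wdiff W W')"
    using frob_inner_le[of m "tangent \<rho> m c W0 x"] mult_right_mono[OF assms(3) frob_norm_nonneg]
    by (rule order_trans)
  finally show ?thesis using assms(1,2) by linarith
qed

lemma lin_event_score:
  assumes "\<xi> \<in> lin_event x_p x_Phi \<rho> m D_p D_Phi e_p e_Phi"
  shows "W \<in> D_p \<xi> \<Longrightarrow> \<bar>score m (init_signs m (fst \<xi>)) W (x_p s a s')
      - lin_score \<rho> m (init_signs m (fst \<xi>)) (init_weights m (fst \<xi>)) W (x_p s a s')\<bar> \<le> e_p"
    and "V \<in> D_Phi \<xi> \<Longrightarrow> \<bar>score m (init_signs m (snd \<xi>)) V (x_Phi s y)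
      - lin_score \<rho> m (init_signs m (snd \<xi>)) (init_weights m (snd \<xi>)) V (x_Phi s y)\<bar> \<le> e_Phi"
  using assms by (auto simp: lin_event_def SUP_le_iff)

lemma prob_vec_nn: "prob_vec (nn_trans x m c W s a)" "prob_vec (nn_obs x' m c W' s')"
  using prob_vec_softmax by (simp_all add: nn_trans_def[abs_def] nn_obs_def[abs_def])

lemma overlap_bounds:
  assumes "prob_vec \<mu>" "prob_vec \<nu>"
  shows "0 \<le> (\<Sum>z\<in>UNIV. min (\<mu> z) (\<nu> z))" "(\<Sum>z\<in>UNIV. min (\<mu> z) (\<nu> z)) \<le> 1"
  using assms tv_eq_overlap[OF assms] tv_nonneg[of \<mu> \<nu>] by (auto simp: prob_vec_def intro!: sum_nonneg)

lemma kappa_Phi_nonneg: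
  assumes "D \<noteq> {}"
  shows "0 \<le> kappa_Phi x m c D"
  unfolding kappa_Phi_def using assms by (intro cINF_greatest overlap_bounds prob_vec_nn) auto

text \<open>The infimum over the weights needs a lower bound, the others range over finite types.\<close>

lemma kappa_P_le:
  assumes "W \<in> D"
  shows "kappa_P x m c D \<le> (\<Sum>z\<in>UNIV. min (nn_trans x m c W s a z) (nn_trans x m c W s'' a z))"
  unfolding kappa_P_def
  by (rule cINF_lower2[OF _ assms] cINF_lower2[OF bdd_below_finite UNIV_I] finite_imageI finite order_refl
      bdd_belowI2[where m = 0] cINF_greatest overlap_bounds prob_vec_nn UNIV_not_empty)+

lemma kappa_Phi_le:
  assumes "W \<in> D"
  shows "kappa_Phi x m c D \<le> (\<Sum>y\<in>UNIV. min (nn_obs x m c W s y) (nn_obs x m c W s'' y))"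
  unfolding kappa_Phi_def
  by (rule cINF_lower2[OF _ assms] cINF_lower2[OF bdd_below_finite UNIV_I] finite_imageI finite order_refl
      bdd_belowI2[where m = 0] cINF_greatest overlap_bounds prob_vec_nn UNIV_not_empty)+

lemma kappa_le_1:
  shows "W \<in> D \<Longrightarrow> kappa_P x m c D \<le> 1" and "V \<in> D' \<Longrightarrow> kappa_Phi x' m c D' \<le> 1"
  by (rule order_trans[OF kappa_P_le overlap_bounds(2)] order_trans[OF kappa_Phi_le overlap_bounds(2)];
      simp add: prob_vec_nn)+

text \<open>
  The overlap coefficients need not converge as the width grows, so this is not a limit of products;
  boundedness of the factor suffices.
\<close>

lemma bounded_factor_tendsto_0:
  fixes \<kappa> e d :: "nat \<Rightarrow> real"
  assumes \<kappa>: "\<And>n. n \<ge> 1 \<Longrightarrow> 0 \<le> \<kappa> n \<and> \<kappa> n \<le> 1" and e: "e \<longlonglongrightarrow> 0" and d: "d \<longlonglongrightarrow> 0"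
  shows "(\<lambda>n. 2 * d n + (3 - 2 * \<kappa> n) * e n) \<longlonglongrightarrow> 0"
proof -
  have "(\<lambda>n. (3 - 2 * \<kappa> n) * e n) \<longlonglongrightarrow> 0"
  proof (rule Lim_null_comparison)
    show "\<forall>\<^sub>F n in sequentially. norm ((3 - 2 * \<kappa> n) * e n) \<le> 3 * \<bar>e n\<bar>"
      using eventually_ge_at_top[of 1]
    proof eventually_elim
      case (elim n)
      then show ?case
        using \<kappa>[of n] mult_right_mono[of "\<bar>3 - 2 * \<kappa> n\<bar>" 3 "\<bar>e n\<bar>"] by (simp add: abs_mult)
    qed
    show "(\<lambda>n. 3 * \<bar>e n\<bar>) \<longlonglongrightarrow> 0"
      using tendsto_mult_right_zero[OF tendsto_rabs_zero[OF e]] .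
  qed
  then show ?thesis
    using tendsto_add[OF tendsto_mult_right_zero[OF d, of 2]] by simp
qed

theorem corollary4p5:
  fixes x_p :: "'s::finite \<Rightarrow> 'a::finite \<Rightarrow> 's \<Rightarrow> real^'p::finite"
    and x_Phi :: "'s \<Rightarrow> 'o::finite \<Rightarrow> real^'q::finite"
    and D_p :: "nat \<Rightarrow> 'p draws \<times> 'q draws \<Rightarrow> 'p weights set"
    and D_Phi :: "nat \<Rightarrow> 'p draws \<times> 'q draws \<Rightarrow> 'q weights set"
    and eps_p eps_Phi :: "nat \<Rightarrow> real \<Rightarrow> real"
    and B :: "nat \<Rightarrow> real"
    and P_true :: "'s \<Rightarrow> 'a \<Rightarrow> 's pmf" and Phi_true :: "'s \<Rightarrow> 'o pmf" and \<nu>0 :: "'s pmf"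
    and \<rho> \<delta> :: real
  assumes "0 \<le> \<rho>" "\<rho> \<le> 1" and "0 < \<delta>" "\<delta> < 1"
  shows
    "(\<forall>m. lin_regime x_p x_Phi \<rho> m \<delta> (D_p m) (D_Phi m) (eps_p m \<delta>) (eps_Phi m \<delta>) \<longrightarrow>
       (\<forall>\<xi> \<in> lin_event x_p x_Phi \<rho> m (D_p m) (D_Phi m) (eps_p m \<delta>) (eps_Phi m \<delta>).
        \<forall>W_p \<in> D_p m \<xi>. \<forall>W_Phi \<in> D_Phi m \<xi>. \<forall>Ws_p \<in> D_p m \<xi>. \<forall>Ws_Phi \<in> D_Phi m \<xi>.
        let c_p = init_signs m (fst \<xi>); c_Phi = init_signs m (snd \<xi>);
            P = nn_trans x_p m c_p; \<Phi> = nn_obs x_Phi m c_Phi;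
            \<kappa>P = kappa_P x_p m c_p (D_p m \<xi>); \<kappa>\<Phi> = kappa_Phi x_Phi m c_Phi (D_Phi m \<xi>);
            \<alpha> = (1 - \<kappa>P) * (4 - 3 * \<kappa>\<Phi>)
        in
          (\<forall>s a s'. pmf (P_true s a) s' = P Ws_p s a s') \<longrightarrow>
          (\<forall>s y. pmf (Phi_true s) y = \<Phi> Ws_Phi s y) \<longrightarrow>
          (\<forall>s a s'. frob_norm m (tangent \<rho> m c_p (init_weights m (fst \<xi>)) (x_p s a s')) \<le> B m) \<longrightarrow>
          (\<forall>s y. frob_norm m (tangent \<rho> m c_Phi (init_weights m (snd \<xi>)) (x_Phi s y)) \<le> B m) \<longrightarrow>
          \<alpha> < 1 \<longrightarrow>
          (\<forall>a. \<forall>t\<ge>1.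
            measure_pmf.expectation (obs_law P_true Phi_true \<nu>0 a t)
              (\<lambda>y. tv (belief (P W_p) (\<Phi> W_Phi) \<nu>0 a y t) (belief (P Ws_p) (\<Phi> Ws_Phi) \<nu>0 a y t))
            \<le> (1 - \<alpha> ^ t) / (1 - \<alpha>)
               * c_b m (B m) \<kappa>\<Phi> (eps_p m \<delta>) (eps_Phi m \<delta>) W_p Ws_p W_Phi Ws_Phi)))
     \<and>
     (\<forall>\<xi> W_p Ws_p W_Phi Ws_Phi.
        (\<forall>n\<ge>1. let m = 2 * n in
           lin_regime x_p x_Phi \<rho> m \<delta> (D_p m) (D_Phi m) (eps_p m \<delta>) (eps_Phi m \<delta>) \<and>
           \<xi> n \<in> space (init_law m) \<and>
           W_p n \<in> D_p m (\<xi> n) \<and> Ws_p n \<in> D_p m (\<xi> n) \<and>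
           W_Phi n \<in> D_Phi m (\<xi> n) \<and> Ws_Phi n \<in> D_Phi m (\<xi> n)) \<longrightarrow>
        (\<lambda>n. eps_p (2 * n) \<delta>) \<longlonglongrightarrow> 0 \<longrightarrow>
        (\<lambda>n. eps_Phi (2 * n) \<delta>) \<longlonglongrightarrow> 0 \<longrightarrow>
        (\<lambda>n. let m = 2 * n;
                 \<kappa>\<Phi> = kappa_Phi x_Phi m (init_signs m (snd (\<xi> n))) (D_Phi m (\<xi> n))
             in c_b m (B m) \<kappa>\<Phi> (eps_p m \<delta>) (eps_Phi m \<delta>) (W_p n) (Ws_p n) (W_Phi n) (Ws_Phi n)
                - (B m * frob_norm m (wdiff (W_Phi n) (Ws_Phi n))
                   + (3 - 2 * \<kappa>\<Phi>) * (B m / 2 * frob_norm m (wdiff (W_p n) (Ws_p n)))))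
        \<longlonglongrightarrow> 0)"
proof (intro conjI allI impI ballI, unfold Let_def, goal_cases)
  case (1 m \<xi> W_p W_Phi Ws_p Ws_Phi)
  define c_p where "c_p = init_signs m (fst \<xi>)"
  define c_Phi where "c_Phi = init_signs m (snd \<xi>)"
  define \<kappa>P where "\<kappa>P = kappa_P x_p m c_p (D_p m \<xi>)"
  define \<kappa>\<Phi> where "\<kappa>\<Phi> = kappa_Phi x_Phi m c_Phi (D_Phi m \<xi>)"
  show ?case
    unfolding c_p_def[symmetric] c_Phi_def[symmetric] \<kappa>P_def[symmetric] \<kappa>\<Phi>_def[symmetric]
  proof (intro allI impI)
    fix a t
    assume Pt: "\<forall>s a s'. pmf (P_true s a) s' = nn_trans x_p m c_p Ws_p s a s'"
      and Phit: "\<forall>s y. pmf (Phi_true s) y = nn_obs x_Phi m c_Phi Ws_Phi s y"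
      and B_p: "\<forall>s a s'. frob_norm m (tangent \<rho> m c_p (init_weights m (fst \<xi>)) (x_p s a s')) \<le> B m"
      and B_Phi: "\<forall>s y. frob_norm m (tangent \<rho> m c_Phi (init_weights m (snd \<xi>)) (x_Phi s y)) \<le> B m"
      and \<alpha>: "(1 - \<kappa>P) * (4 - 3 * \<kappa>\<Phi>) < 1"
    have P_eq: "nn_trans x_p m c_p Ws_p = (\<lambda>s a. pmf (P_true s a))"
      and Phi_eq: "nn_obs x_Phi m c_Phi Ws_Phi = (\<lambda>s. pmf (Phi_true s))"
      using Pt Phit by (auto simp: fun_eq_iff)
    define e_p where "e_p = (B m * frob_norm m (wdiff W_p Ws_p) + 2 * eps_p m \<delta>) / 2"
    define e_Phi where "e_Phi = (B m * frob_norm m (wdiff W_Phi Ws_Phi) + 2 * eps_Phi m \<delta>) / 2"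
    have e_p: "tv (nn_trans x_p m c_p W_p s a) (pmf (P_true s a)) \<le> e_p" for s a
    proof -
      have "tv (nn_trans x_p m c_p W_p s a) (nn_trans x_p m c_p Ws_p s a) \<le> e_p"
        unfolding nn_trans_def[abs_def] e_p_def c_p_def
        by (intro tv_softmax_le score_diff_le[where \<rho> = \<rho> and ?W0.0 = "init_weights m (fst \<xi>)"]
            lin_event_score[OF 1(2)] 1 B_p[unfolded c_p_def, rule_format])
      then show ?thesis by (simp add: P_eq)
    qed
    have e_Phi: "tv (nn_obs x_Phi m c_Phi W_Phi s) (pmf (Phi_true s)) \<le> e_Phi" for s
    proof -
      have "tv (nn_obs x_Phi m c_Phi W_Phi s) (nn_obs x_Phi m c_Phi Ws_Phi s) \<le> e_Phi"
        unfolding nn_obs_def[abs_def] e_Phi_def c_Phi_def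
        by (intro tv_softmax_le score_diff_le[where \<rho> = \<rho> and ?W0.0 = "init_weights m (snd \<xi>)"]
            lin_event_score[OF 1(2)] 1 B_Phi[unfolded c_Phi_def, rule_format])
      then show ?thesis by (simp add: Phi_eq)
    qed
    have "measure_pmf.expectation (obs_law P_true Phi_true \<nu>0 a t)
        (\<lambda>y. tv (belief (nn_trans x_p m c_p W_p) (nn_obs x_Phi m c_Phi W_Phi) \<nu>0 a y t)
          (belief (\<lambda>s a. pmf (P_true s a)) (\<lambda>s. pmf (Phi_true s)) \<nu>0 a y t))
      \<le> (1 - ((1 - \<kappa>P) * (4 - 3 * \<kappa>\<Phi>)) ^ t) / (1 - (1 - \<kappa>P) * (4 - 3 * \<kappa>\<Phi>))
         * (2 * e_Phi + (3 - 2 * \<kappa>\<Phi>) * e_p)"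
    proof (rule expected_belief_error_le[OF _ prob_vec_nn(1) prob_vec_nn(2) _ _ _ _ _ e_p e_Phi \<alpha>])
      show "0 < pmf (Phi_true s) u" "0 < nn_obs x_Phi m c_Phi W_Phi s u" for s u
        by (simp_all add: Phit nn_obs_def softmax_pos)
    qed (use 1 in \<open>auto simp: \<kappa>P_def \<kappa>\<Phi>_def intro: kappa_P_le kappa_Phi_le kappa_le_1\<close>)
    also have "2 * e_Phi + (3 - 2 * \<kappa>\<Phi>) * e_p
        = c_b m (B m) \<kappa>\<Phi> (eps_p m \<delta>) (eps_Phi m \<delta>) W_p Ws_p W_Phi Ws_Phi"
      by (simp add: e_p_def e_Phi_def c_b_def add_divide_distrib)
    finally show "measure_pmf.expectation (obs_law P_true Phi_true \<nu>0 a t)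
        (\<lambda>y. tv (belief (nn_trans x_p m c_p W_p) (nn_obs x_Phi m c_Phi W_Phi) \<nu>0 a y t)
          (belief (nn_trans x_p m c_p Ws_p) (nn_obs x_Phi m c_Phi Ws_Phi) \<nu>0 a y t))
      \<le> (1 - ((1 - \<kappa>P) * (4 - 3 * \<kappa>\<Phi>)) ^ t) / (1 - (1 - \<kappa>P) * (4 - 3 * \<kappa>\<Phi>))
         * c_b m (B m) \<kappa>\<Phi> (eps_p m \<delta>) (eps_Phi m \<delta>) W_p Ws_p W_Phi Ws_Phi"
      by (simp only: P_eq Phi_eq)
  qed
next
  case (2 \<xi> W_p Ws_p W_Phi Ws_Phi)
  define \<kappa> where
    "\<kappa> n = kappa_Phi x_Phi (2 * n) (init_signs (2 * n) (snd (\<xi> n))) (D_Phi (2 * n) (\<xi> n))" for n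
  have \<kappa>: "0 \<le> \<kappa> n \<and> \<kappa> n \<le> 1" if "n \<ge> 1" for n
  proof -
    have "W_Phi n \<in> D_Phi (2 * n) (\<xi> n)" using 2(1) that by auto
    then show ?thesis
      unfolding \<kappa>_def by (intro conjI kappa_Phi_nonneg kappa_le_1(2)) auto
  qed
  show ?case
    unfolding \<kappa>_def[symmetric] c_b_def
    using bounded_factor_tendsto_0[where \<kappa> = \<kappa>, OF \<kappa> 2(2) 2(3)] by (simp add: algebra_simps)
qed

end
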